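(* For any ring $R$, there is an $O(n^2)$-time deterministic reduction from $\mathrm{AllZeroes}_R$ on $n\times n$ matrices to $\mathrm{IV}_R$ on $3n\times 3n$ matrices.
   Context: $\mathrm{AllZeroes}_R$: given $A,B\in R^{n\times n}$, decide whether $AB = 0$. $\mathrm{IV}_R$ (Inverse Verification): given $A,B\in R^{n\times n}$, decide whether $B = A^{-1}$ (i.e., whether $AB = I$). A reduction maps each instance of the first problem to an instance of the second with the same yes/no answer; arithmetic operations over $R$ are counted as constant time. *)

theory Defs
  imports "Jordan_Normal_Form.Matrix" "HOL-Library.Landau_Symbols"
begin

section \<open>A random access machine over a ring\<close>

text \<open>
  A state consists of index registers holding natural numbers and of arrays (named by natural
  numbers) of ring elements.  A location \<open>(k, r)\<close> stands for the cell of array \<open>k\<close> whose address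
  is the content of index register \<open>r\<close>.  Index arithmetic is limited to successor and predecessor,
  so after \<open>t\<close> steps every register is bounded by the largest initial register plus \<open>t\<close> plus a
  constant: charging unit cost for index operations cannot be abused by computing with huge numbers.

  The sort \<open>{ring, monoid_mult}\<close> describes unital, not necessarily commutative rings; unlike
  \<open>ring_1\<close> it does not exclude the zero ring.
\<close>

type_synonym 'a state = "(nat \<Rightarrow> nat) \<times> (nat \<Rightarrow> nat \<Rightarrow> 'a)"

type_synonym loc = "nat \<times> nat"

datatype instr =
    Nop
  | IConst nat nat
  | ICopy nat nat
  | ISuc nat
  | IPred nat
  | RZero loc
  | ROne loc
  | RCopy loc loc
  | RAdd loc loc loc
  | RSub loc loc loc
  | RMult loc loc loc

datatype test =
    ILess nat nat
  | IEq nat nat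
  | REq loc loc
  | Neg test

datatype com =
    Instr instr
  | Seq com com
  | Cond test com com
  | While test com

fun fetch :: "'a state \<Rightarrow> loc \<Rightarrow> 'a" where
  "fetch (I, M) (k, r) = M k (I r)"

fun iput :: "nat \<Rightarrow> nat \<Rightarrow> 'a state \<Rightarrow> 'a state" where
  "iput r v (I, M) = (I(r := v), M)"

fun rput :: "loc \<Rightarrow> 'a \<Rightarrow> 'a state \<Rightarrow> 'a state" where
  "rput (k, r) x (I, M) = (I, M(k := (M k)(I r := x)))"

text \<open>The first argument of an instruction is its target.\<close>

fun exec :: "instr \<Rightarrow> 'a::{ring,monoid_mult} state \<Rightarrow> 'a state" where
  "exec Nop s = s"
| "exec (IConst r v) s = iput r v s"
| "exec (ICopy r q) s = iput r (fst s q) s"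
| "exec (ISuc r) s = iput r (fst s r + 1) s"
| "exec (IPred r) s = iput r (fst s r - 1) s"
| "exec (RZero l) s = rput l 0 s"
| "exec (ROne l) s = rput l 1 s"
| "exec (RCopy l a) s = rput l (fetch s a) s"
| "exec (RAdd l a b) s = rput l (fetch s a + fetch s b) s"
| "exec (RSub l a b) s = rput l (fetch s a - fetch s b) s"
| "exec (RMult l a b) s = rput l (fetch s a * fetch s b) s"

fun holds :: "test \<Rightarrow> 'a state \<Rightarrow> bool" where
  "holds (ILess r q) s \<longleftrightarrow> fst s r < fst s q"
| "holds (IEq r q) s \<longleftrightarrow> fst s r = fst s q"
| "holds (REq a b) s \<longleftrightarrow> fetch s a = fetch s b"
| "holds (Neg b) s \<longleftrightarrow> \<not> holds b s"

text \<open>\<open>runs c s t s'\<close>: started in \<open>s\<close>, program \<open>c\<close> halts in \<open>s'\<close> after exactly \<open>t\<close> steps, where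
  each instruction and each evaluation of a test is one step.\<close>

inductive runs :: "com \<Rightarrow> 'a::{ring,monoid_mult} state \<Rightarrow> nat \<Rightarrow> 'a state \<Rightarrow> bool" where
  runs_Instr: "runs (Instr i) s 1 (exec i s)"
| runs_Seq: "runs c1 s t1 s' \<Longrightarrow> runs c2 s' t2 s'' \<Longrightarrow> runs (Seq c1 c2) s (t1 + t2) s''"
| runs_CondT: "holds b s \<Longrightarrow> runs c1 s t s' \<Longrightarrow> runs (Cond b c1 c2) s (1 + t) s'"
| runs_CondF: "\<not> holds b s \<Longrightarrow> runs c2 s t s' \<Longrightarrow> runs (Cond b c1 c2) s (1 + t) s'"
| runs_WhileF: "\<not> holds b s \<Longrightarrow> runs (While b c) s 1 s"
| runs_WhileT: "holds b s \<Longrightarrow> runs c s t1 s' \<Longrightarrow> runs (While b c) s' t2 s'' \<Longrightarrow>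
    runs (While b c) s (1 + t1 + t2) s''"

inductive_cases runs_InstrE: "runs (Instr i) s t s'"
inductive_cases runs_SeqE: "runs (Seq c1 c2) s t s'"
inductive_cases runs_CondE: "runs (Cond b c1 c2) s t s'"
inductive_cases runs_WhileE: "runs (While b c) s t s'"

lemma runs_deterministic:
  assumes "runs c s t s1" and "runs c s u s2"
  shows "u = t \<and> s2 = s1"
  using assms
proof (induction arbitrary: u s2 rule: runs.induct)
  case (runs_Instr i s)
  then show ?case by (auto elim: runs_InstrE)
next
  case (runs_Seq c1 s t1 s' c2 t2 s'')
  from runs_Seq.prems obtain u1 u2 r where
    r: "u = u1 + u2" "runs c1 s u1 r" "runs c2 r u2 s2" by (rule runs_SeqE)
  from runs_Seq.IH(1)[OF r(2)] r(3) have "u1 = t1" "runs c2 s' u2 s2" by simp_all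
  with runs_Seq.IH(2) r(1) show ?case by simp
next
  case (runs_CondT b s c1 t s' c2)
  from runs_CondT.prems runs_CondT.hyps(1) obtain u' where "u = 1 + u'" "runs c1 s u' s2"
    by (rule_tac runs_CondE) auto
  with runs_CondT.IH show ?case by simp
next
  case (runs_CondF b s c2 t s' c1)
  from runs_CondF.prems runs_CondF.hyps(1) obtain u' where "u = 1 + u'" "runs c2 s u' s2"
    by (rule_tac runs_CondE) auto
  with runs_CondF.IH show ?case by simp
next
  case (runs_WhileF b s c)
  from runs_WhileF.prems show ?case
    by (rule runs_WhileE) (simp_all add: runs_WhileF.hyps)
next
  case (runs_WhileT b s c t1 s' t2 s'')
  from runs_WhileT.prems runs_WhileT.hyps(1) obtain u1 u2 r where
    r: "u = 1 + u1 + u2" "runs c s u1 r" "runs (While b c) r u2 s2"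
    by (rule_tac runs_WhileE) auto
  from runs_WhileT.IH(1)[OF r(2)] r(3) have "u1 = t1" "runs (While b c) s' u2 s2" by simp_all
  with runs_WhileT.IH(2) r(1) show ?case by simp
qed

section \<open>Problems on pairs of square matrices and reductions\<close>

text \<open>An instance of size \<open>n\<close> is a pair of \<open>n \<times> n\<close> matrices.  It is stored with \<open>n\<close> in index
  register 0 and the two matrices in row-major order in arrays 0 and 1.\<close>

definition stores_instance :: "nat \<Rightarrow> 'a mat \<Rightarrow> 'a mat \<Rightarrow> 'a state \<Rightarrow> bool" where
  "stores_instance n A B s \<longleftrightarrow> fst s 0 = n \<and>
     (\<forall>i<n. \<forall>j<n. snd s 0 (i * n + j) = A $$ (i, j) \<and> snd s 1 (i * n + j) = B $$ (i, j))"

definition input_state :: "nat \<Rightarrow> 'a::zero mat \<Rightarrow> 'a mat \<Rightarrow> 'a state" where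
  "input_state n A B =
     ((\<lambda>r. if r = 0 then n else 0),
      (\<lambda>k p. if p < n * n then
               (if k = 0 then A $$ (p div n, p mod n)
                else if k = 1 then B $$ (p div n, p mod n) else 0)
             else 0))"

lemma stores_instance_input_state: "stores_instance n A B (input_state n A B)"
proof -
  have "i * n + j < n * n" if "i < n" "j < n" for i j
  proof -
    have "i * n + j < Suc i * n" using that by simp
    also have "\<dots> \<le> n * n" using that by (intro mult_le_mono1) simp
    finally show ?thesis .
  qed
  then show ?thesis
    unfolding stores_instance_def input_state_def by simp
qed

type_synonym 'a matrix_problem = "nat \<Rightarrow> 'a mat \<Rightarrow> 'a mat \<Rightarrow> bool"

definition all_zeroes :: "'a::{ring,monoid_mult} matrix_problem" where
  "all_zeroes n A B \<longleftrightarrow> A * B = 0\<^sub>m n n"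

definition inverse_verification :: "'a::{ring,monoid_mult} matrix_problem" where
  "inverse_verification n A B \<longleftrightarrow> A * B = 1\<^sub>m n"

text \<open>One program for all sizes maps instances of \<open>P\<close> of size \<open>n\<close> to instances of \<open>Q\<close> of size
  \<open>m n\<close> with the same answer, within \<open>T n\<close> steps.\<close>

definition reduces_within ::
  "'a::{ring,monoid_mult} matrix_problem \<Rightarrow> 'a matrix_problem \<Rightarrow> (nat \<Rightarrow> nat) \<Rightarrow> (nat \<Rightarrow> nat) \<Rightarrow> bool"
where
  "reduces_within P Q m T \<longleftrightarrow>
     (\<exists>c. \<forall>n. \<forall>A \<in> carrier_mat n n. \<forall>B \<in> carrier_mat n n.
        \<exists>t s. runs c (input_state n A B) t s \<and> t \<le> T n \<and>
          (\<exists>A' \<in> carrier_mat (m n) (m n). \<exists>B' \<in> carrier_mat (m n) (m n).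
             stores_instance (m n) A' B' s \<and> (P n A B \<longleftrightarrow> Q (m n) A' B')))"

end

theory Submission
  imports Defs
begin

text \<open>
  Let \<open>X\<close> be the \<open>3n \<times> 3n\<close> block matrix whose only nonzero blocks are \<open>A\<close> at position (1,2) and
  \<open>B\<close> at position (2,3).  Its square has \<open>A B\<close> at position (1,3) and is zero elsewhere, so
  \<open>(1 + X) (1 - X) = 1 - X\<^sup>2\<close> is the identity iff \<open>A B = 0\<close>.  The entries of \<open>1 + X\<close> and
  \<open>1 - X\<close> can be written in row-major order in constant time each, because in that order the
  entries of \<open>A\<close> and those of \<open>B\<close> are consumed in row-major order as well.
\<close>

section \<open>Total correctness with time bounds\<close>

text \<open>The time is only bounded from above, so that branches of different length share one
  triple and bounds add up along \<open>Seq\<close>.\<close>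

definition hoare ::
  "('a::{ring,monoid_mult} state \<Rightarrow> bool) \<Rightarrow> com \<Rightarrow> nat \<Rightarrow> ('a state \<Rightarrow> bool) \<Rightarrow> bool" where
  "hoare P c t Q \<longleftrightarrow> (\<forall>s. P s \<longrightarrow> (\<exists>u s'. u \<le> t \<and> runs c s u s' \<and> Q s'))"

lemma hoare_Seq:
  assumes "hoare P c1 t1 Q" and "hoare Q c2 t2 R"
  shows "hoare P (Seq c1 c2) (t1 + t2) R"
  using assms unfolding hoare_def by (meson add_mono runs_Seq)

fun loop_free :: "com \<Rightarrow> bool" where
  "loop_free (Instr i) \<longleftrightarrow> True"
| "loop_free (Seq c1 c2) \<longleftrightarrow> loop_free c1 \<and> loop_free c2"
| "loop_free (Cond b c1 c2) \<longleftrightarrow> loop_free c1 \<and> loop_free c2"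
| "loop_free (While b c) \<longleftrightarrow> False"

text \<open>Lets the simplifier compute the effect of code without loops. The \<open>While\<close>
  clauses here and in \<open>cost\<close> are dummies, guarded against by
  \<open>loop_free\<close>.\<close>

fun result :: "com \<Rightarrow> 'a::{ring,monoid_mult} state \<Rightarrow> 'a state" where
  "result (Instr i) s = exec i s"
| "result (Seq c1 c2) s = result c2 (result c1 s)"
| "result (Cond b c1 c2) s = (if holds b s then result c1 s else result c2 s)"
| "result (While b c) s = s"

fun cost :: "com \<Rightarrow> nat" where
  "cost (Instr i) = 1"
| "cost (Seq c1 c2) = cost c1 + cost c2"
| "cost (Cond b c1 c2) = 1 + max (cost c1) (cost c2)"
| "cost (While b c) = 0"

lemma runs_loop_free:
  "loop_free c \<Longrightarrow> \<exists>u \<le> cost c. runs c s u (result c s)"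
proof (induction c arbitrary: s)
  case (Instr i)
  show ?case using runs_Instr[of i s] by auto
next
  case (Seq c1 c2)
  from Seq.IH(1)[of s] Seq.prems obtain u where u: "u \<le> cost c1" "runs c1 s u (result c1 s)"
    by auto
  from Seq.IH(2)[of "result c1 s"] Seq.prems obtain v
    where v: "v \<le> cost c2" "runs c2 (result c1 s) v (result c2 (result c1 s))"
    by auto
  from runs_Seq[OF u(2) v(2)] u(1) v(1) show ?case
    by (intro exI[of _ "u + v"]) auto
next
  case (Cond b c1 c2)
  show ?case
  proof (cases "holds b s")
    case True
    from Cond.IH(1)[of s] Cond.prems obtain u where u: "u \<le> cost c1" "runs c1 s u (result c1 s)"
      by auto
    from runs_CondT[OF True u(2), of c2] u(1) True show ?thesis
      by (intro exI[of _ "1 + u"]) auto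
  next
    case False
    from Cond.IH(2)[of s] Cond.prems obtain u where u: "u \<le> cost c2" "runs c2 s u (result c2 s)"
      by auto
    from runs_CondF[OF False u(2), of c1] u(1) False show ?thesis
      by (intro exI[of _ "1 + u"]) auto
  qed
qed simp

lemma hoare_loop_free:
  assumes "loop_free c" and "cost c \<le> t" and "\<And>R M. P (R, M) \<Longrightarrow> Q (result c (R, M))"
  shows "hoare P c t Q"
  unfolding hoare_def
proof (intro allI impI)
  fix s assume "P s"
  then have "Q (result c s)" using assms(3) by (cases s) auto
  then show "\<exists>u s'. u \<le> t \<and> runs c s u s' \<and> Q s'"
    using runs_loop_free[OF assms(1), of s] assms(2) order_trans by blast
qed

text \<open>The invariant ties the counter \<open>r\<close> to \<open>k\<close> and the limit
  \<open>q\<close> to \<open>m\<close>, so the loop makes \<open>m\<close> rounds, each paying for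
  the body and one test; the final failing test adds 1.\<close>

lemma hoare_for:
  assumes regs: "\<And>k s. Inv k s \<Longrightarrow> fst s r = k \<and> fst s q = m"
    and body: "\<And>k. k < m \<Longrightarrow> hoare (Inv k) c t (Inv (Suc k))"
  shows "hoare (Inv 0) (While (ILess r q) c) (m * (t + 1) + 1) (Inv m)"
proof -
  \<comment> \<open>Induction on the number \<open>d\<close> of remaining rounds, because
    \<open>runs_WhileT\<close> splits off the first one.\<close>
  have "hoare (Inv (m - d)) (While (ILess r q) c) (d * (t + 1) + 1) (Inv m)" if "d \<le> m" for d
    using that
  proof (induction d)
    case 0
    show ?case
      unfolding hoare_def
    proof (intro allI impI)
      fix s :: "'a state" assume s: "Inv (m - 0) s"
      have "\<not> holds (ILess r q) s" using regs[OF s] by simp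
      from runs_WhileF[OF this] s
      show "\<exists>u s'. u \<le> 0 * (t + 1) + 1 \<and> runs (While (ILess r q) c) s u s' \<and> Inv m s'"
        by (intro exI[of _ 1] exI[of _ s]) simp
    qed
  next
    case (Suc d)
    show ?case
      unfolding hoare_def
    proof (intro allI impI)
      fix s :: "'a state" assume s: "Inv (m - Suc d) s"
      have b: "holds (ILess r q) s" using regs[OF s] Suc.prems by auto
      have "hoare (Inv (m - Suc d)) c t (Inv (m - d))"
        using body[of "m - Suc d"] Suc.prems by (simp add: Suc_diff_Suc)
      with s obtain u s' where u: "u \<le> t" "runs c s u s'" "Inv (m - d) s'"
        unfolding hoare_def by blast
      from Suc.IH Suc.prems u(3) obtain v s'' where
        v: "v \<le> d * (t + 1) + 1" "runs (While (ILess r q) c) s' v s''" "Inv m s''"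
        unfolding hoare_def by (meson Suc_leD)
      from runs_WhileT[OF b u(2) v(2)] u(1) v
      show "\<exists>u s'. u \<le> Suc d * (t + 1) + 1 \<and> runs (While (ILess r q) c) s u s' \<and> Inv m s'"
        by (intro exI[of _ "1 + u + v"] exI[of _ s'']) auto
    qed
  qed
  from this[of m] show ?thesis by simp
qed

text \<open>The inner counter is reset at the end of a row, so that both counters are 0 on entry.\<close>

definition double_loop :: "nat \<Rightarrow> nat \<Rightarrow> nat \<Rightarrow> com \<Rightarrow> com" where
  "double_loop r r' q c =
     While (ILess r q)
       (Seq (While (ILess r' q) c) (Seq (Instr (ISuc r)) (Instr (IConst r' 0))))"

text \<open>Each row costs \<open>m * (t + 1) + 1\<close> for the inner loop, 2 for the counter
  updates and 1 for the outer test. In \<open>row\<close>, the end of one row is reinterpreted as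
  the start of the next.\<close>

lemma hoare_double_loop:
  assumes regs: "\<And>i j s. Inv i j s \<Longrightarrow> fst s r = i \<and> fst s r' = j \<and> fst s q = m"
    and body: "\<And>i j. i < m \<Longrightarrow> j < m \<Longrightarrow> hoare (Inv i j) c t (Inv i (Suc j))"
    and row: "\<And>i R M. i < m \<Longrightarrow> Inv i m (R, M) \<Longrightarrow> Inv (Suc i) 0 (R(r := Suc i, r' := 0), M)"
  shows "hoare (Inv 0 0) (double_loop r r' q c) (m * (m * (t + 1) + 4) + 1) (Inv m 0)"
proof -
  have "hoare (Inv i 0) (Seq (While (ILess r' q) c) (Seq (Instr (ISuc r)) (Instr (IConst r' 0))))
     (m * (t + 1) + 3) (Inv (Suc i) 0)" if "i < m" for i
  proof -
    have 1: "hoare (Inv i 0) (While (ILess r' q) c) (m * (t + 1) + 1) (Inv i m)"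
      using hoare_for[of "Inv i" r' q m c t] regs body that by blast
    have 2: "hoare (Inv i m) (Seq (Instr (ISuc r)) (Instr (IConst r' 0))) 2 (Inv (Suc i) 0)"
      using row[OF that] regs[of i m] by (intro hoare_loop_free) fastforce+
    from hoare_Seq[OF 1 2] show ?thesis by (simp add: numeral_3_eq_3)
  qed
  from hoare_for[of "\<lambda>i. Inv i 0" r q m, OF _ this] regs show ?thesis
    unfolding double_loop_def by (simp add: eval_nat_numeral)
qed

section \<open>The block matrices\<close>

text \<open>The matrix X, with A and B taken from flat row-major arrays as the machine stores
  them.\<close>

definition block_entry :: "nat \<Rightarrow> (nat \<Rightarrow> 'a::zero) \<Rightarrow> (nat \<Rightarrow> 'a) \<Rightarrow> nat \<Rightarrow> nat \<Rightarrow> 'a" where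
  "block_entry n a b i j =
     (if i < n \<and> n \<le> j \<and> j < 2 * n then a (i * n + (j - n))
      else if n \<le> i \<and> i < 2 * n \<and> 2 * n \<le> j then b ((i - n) * n + (j - 2 * n))
      else 0)"

definition delta :: "nat \<Rightarrow> nat \<Rightarrow> 'a::{zero,one}" where
  "delta i j = (if i = j then 1 else 0)"

lemma sum_delta_mult:
  fixes f :: "nat \<Rightarrow> 'a::{ring,monoid_mult}"
  assumes "i < m"
  shows "(\<Sum>k<m. delta i k * f k) = f i" and "(\<Sum>k<m. f k * delta k i) = f i"
  using assms by (simp_all add: delta_def if_distrib if_distribR cong: if_cong)

text \<open>Distributivity gives 1 - X + X - X X, and the middle terms cancel, even over a
  noncommutative ring.\<close>

lemma sum_one_plus_one_minus:
  fixes x :: "nat \<Rightarrow> nat \<Rightarrow> 'a::{ring,monoid_mult}"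
  assumes "i < m" "j < m"
  shows "(\<Sum>k<m. (delta i k + x i k) * (delta k j - x k j)) = delta i j - (\<Sum>k<m. x i k * x k j)"
proof -
  have "(\<Sum>k<m. (delta i k + x i k) * (delta k j - x k j)) =
      (\<Sum>k<m. delta i k * delta k j) - (\<Sum>k<m. delta i k * x k j) +
      ((\<Sum>k<m. x i k * delta k j) - (\<Sum>k<m. x i k * x k j))"
    by (simp add: sum.distrib sum_subtractf algebra_simps)
  also have "\<dots> = delta i j - (\<Sum>k<m. x i k * x k j)"
    using assms by (simp add: sum_delta_mult)
  finally show ?thesis .
qed

text \<open>X is nonzero only from block row 1 to block column 2 and from block row 2 to block
  column 3, so a nonzero product needs \<open>k\<close> in the middle block.\<close>

lemma sum_block_entry:
  fixes a b :: "nat \<Rightarrow> 'a::{ring,monoid_mult}"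
  shows "(\<Sum>k<3*n. block_entry n a b i k * block_entry n a b k j) =
    (if i < n \<and> 2 * n \<le> j then \<Sum>k<n. a (i * n + k) * b (k * n + (j - 2 * n)) else 0)"
proof (cases "i < n \<and> 2 * n \<le> j")
  case True
  have "(\<Sum>k<3*n. block_entry n a b i k * block_entry n a b k j) =
     (\<Sum>k\<in>{n..<2*n}. a (i * n + (k - n)) * b ((k - n) * n + (j - 2 * n)))"
    using True by (intro sum.mono_neutral_cong_right) (auto simp: block_entry_def)
  also have "\<dots> = (\<Sum>k<n. a (i * n + k) * b (k * n + (j - 2 * n)))"
    by (rule sum.reindex_bij_witness[of _ "\<lambda>k. k + n" "\<lambda>k. k - n"]) auto
  finally show ?thesis using True by simp
next
  case False
  then have "block_entry n a b i k * block_entry n a b k j = 0" for k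
    by (auto simp: block_entry_def)
  with False show ?thesis by auto
qed

definition one_plus_block :: "nat \<Rightarrow> (nat \<Rightarrow> 'a::{ring,monoid_mult}) \<Rightarrow> (nat \<Rightarrow> 'a) \<Rightarrow> 'a mat" where
  "one_plus_block n a b = mat (3 * n) (3 * n) (\<lambda>(i, j). delta i j + block_entry n a b i j)"

definition one_minus_block :: "nat \<Rightarrow> (nat \<Rightarrow> 'a::{ring,monoid_mult}) \<Rightarrow> (nat \<Rightarrow> 'a) \<Rightarrow> 'a mat" where
  "one_minus_block n a b = mat (3 * n) (3 * n) (\<lambda>(i, j). delta i j - block_entry n a b i j)"

lemma all_zeroes_iff_inverse_verification:
  fixes A B :: "'a::{ring,monoid_mult} mat"
  assumes A: "A \<in> carrier_mat n n" and B: "B \<in> carrier_mat n n"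
    and a: "\<And>i j. i < n \<Longrightarrow> j < n \<Longrightarrow> a (i * n + j) = A $$ (i, j)"
    and b: "\<And>i j. i < n \<Longrightarrow> j < n \<Longrightarrow> b (i * n + j) = B $$ (i, j)"
  shows "all_zeroes n A B \<longleftrightarrow>
    inverse_verification (3 * n) (one_plus_block n a b) (one_minus_block n a b)"
proof -
  define p where "p i j = (\<Sum>k<n. A $$ (i, k) * B $$ (k, j))" for i j
  have AB: "all_zeroes n A B \<longleftrightarrow> (\<forall>i<n. \<forall>j<n. p i j = 0)"
    using A B unfolding all_zeroes_def p_def
    by (auto simp: mat_eq_iff scalar_prod_def atLeast0LessThan)
  have entry: "(one_plus_block n a b * one_minus_block n a b) $$ (i, j) =
      delta i j - (if i < n \<and> 2 * n \<le> j then p i (j - 2 * n) else 0)"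
    if "i < 3 * n" "j < 3 * n" for i j
  proof -
    have "(one_plus_block n a b * one_minus_block n a b) $$ (i, j) =
      (\<Sum>k<3*n. (delta i k + block_entry n a b i k) * (delta k j - block_entry n a b k j))"
      using that by (simp add: one_plus_block_def one_minus_block_def scalar_prod_def atLeast0LessThan)
    also have "\<dots> = delta i j - (if i < n \<and> 2 * n \<le> j then p i (j - 2 * n) else 0)"
    proof -
      have "b (k * n + (j - 2 * n)) = B $$ (k, j - 2 * n)" if "k < n" "2 * n \<le> j" for k
        using that \<open>j < 3 * n\<close> by (intro b) auto
      then show ?thesis
        using that by (simp add: sum_one_plus_one_minus sum_block_entry p_def a del: Nat.add_diff_assoc)
    qed
    finally show ?thesis .
  qed
  have "inverse_verification (3 * n) (one_plus_block n a b) (one_minus_block n a b) \<longleftrightarrow>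
      (\<forall>i<3*n. \<forall>j<3*n.
         (one_plus_block n a b * one_minus_block n a b) $$ (i, j) = delta i j)"
    unfolding inverse_verification_def
    by (auto simp: mat_eq_iff delta_def one_plus_block_def one_minus_block_def)
  also have "\<dots> \<longleftrightarrow> (\<forall>i<3*n. \<forall>j<3*n. i < n \<and> 2 * n \<le> j \<longrightarrow> p i (j - 2 * n) = 0)"
    by (auto simp: entry)
  also have "\<dots> \<longleftrightarrow> (\<forall>i<n. \<forall>j<n. p i j = 0)"
  proof (intro iffI allI impI)
    fix i j assume *: "\<forall>i<3*n. \<forall>j<3*n. i < n \<and> 2 * n \<le> j \<longrightarrow> p i (j - 2 * n) = 0" "i < n" "j < n"
    \<comment> \<open>Column \<open>j\<close> of A B sits in column \<open>j + 2 * n\<close> of the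
      large product.\<close>
    then show "p i j = 0" using *(1)[rule_format, of i "j + 2 * n"] by simp
  qed auto
  finally show ?thesis using AB by simp
qed

section \<open>The program\<close>

text \<open>Register 0 holds the size, 1 and 2 the row and the column, 3 the position in the matrix being
  traversed, 4 and 5 the positions in the saved copies of \<open>A\<close> and \<open>B\<close> (arrays 2 and 3), 6 and 7
  the numbers \<open>2n\<close> and \<open>3n\<close>.\<close>

definition save_body :: com where
  "save_body =
     Seq (Instr (RCopy (2, 3) (0, 3)))
    (Seq (Instr (RCopy (3, 3) (1, 3)))
    (Seq (Instr (ISuc 2)) (Instr (ISuc 3))))"

definition save_inv ::
  "nat \<Rightarrow> (nat \<Rightarrow> 'a) \<Rightarrow> (nat \<Rightarrow> 'a) \<Rightarrow> nat \<Rightarrow> nat \<Rightarrow> 'a state \<Rightarrow> bool" where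
  "save_inv n a b i j s \<longleftrightarrow>
     fst s 0 = n \<and> fst s 1 = i \<and> fst s 2 = j \<and> fst s 3 = i * n + j \<and> fst s 4 = 0 \<and> fst s 5 = 0 \<and>
     snd s 0 = a \<and> snd s 1 = b \<and>
     (\<forall>p < i * n + j. snd s 2 p = a p \<and> snd s 3 p = b p)"

lemma hoare_save:
  "hoare (save_inv n a b 0 0) (double_loop 1 2 0 save_body) (n * (n * 5 + 4) + 1)
     (save_inv n a b n 0)"
proof -
  have "hoare (save_inv n a b i j) save_body 4 (save_inv n a b i (Suc j))" for i j
    by (rule hoare_loop_free) (auto simp: save_body_def save_inv_def less_Suc_eq)
  from hoare_double_loop[of "save_inv n a b" 1 2 0 n, OF _ this] show ?thesis
    by (auto simp: save_inv_def add.commute)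
qed

section \<open>Computing the block boundaries\<close>

definition bounds_init :: com where
  "bounds_init =
     Seq (Instr (IConst 1 0))
    (Seq (Instr (IConst 3 0))
    (Seq (Instr (ICopy 6 0)) (Instr (ICopy 7 0))))"

text \<open>Index registers can only be incremented, so 2n and 3n are reached from n by
  \<open>n\<close> rounds that add 1 and 2.\<close>

definition bounds_body :: com where
  "bounds_body =
     Seq (Instr (ISuc 1)) (Seq (Instr (ISuc 6)) (Seq (Instr (ISuc 7)) (Instr (ISuc 7))))"

definition bounds_inv ::
  "nat \<Rightarrow> (nat \<Rightarrow> 'a) \<Rightarrow> (nat \<Rightarrow> 'a) \<Rightarrow> nat \<Rightarrow> 'a state \<Rightarrow> bool" where
  "bounds_inv n a b k s \<longleftrightarrow>
     fst s 0 = n \<and> fst s 1 = k \<and> fst s 2 = 0 \<and> fst s 3 = 0 \<and> fst s 4 = 0 \<and> fst s 5 = 0 \<and>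
     fst s 6 = n + k \<and> fst s 7 = n + 2 * k \<and>
     (\<forall>p < n * n. snd s 2 p = a p \<and> snd s 3 p = b p)"

lemma hoare_bounds_init: "hoare (save_inv n a b n 0) bounds_init 4 (bounds_inv n a b 0)"
  by (rule hoare_loop_free) (auto simp: bounds_init_def save_inv_def bounds_inv_def)

lemma hoare_bounds:
  "hoare (bounds_inv n a b 0) (While (ILess 1 0) bounds_body) (n * 5 + 1) (bounds_inv n a b n)"
proof -
  have "hoare (bounds_inv n a b k) bounds_body 4 (bounds_inv n a b (Suc k))" for k
    by (rule hoare_loop_free) (auto simp: bounds_body_def bounds_inv_def)
  from hoare_for[of "bounds_inv n a b" 1 0 n, OF _ this] show ?thesis
    by (auto simp: bounds_inv_def)
qed

section \<open>Writing the two block matrices\<close>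

text \<open>Array 4 receives the entry of \<open>X\<close>, array 1 first the entry of the identity matrix.\<close>

definition fill_body :: com where
  "fill_body =
     Seq (Instr (RZero (4, 3)))
    (Seq (Instr (RZero (1, 3)))
    (Seq (Cond (IEq 1 2) (Instr (ROne (1, 3))) (Instr Nop))
    (Seq (Cond (ILess 1 0)
            (Cond (ILess 2 0) (Instr Nop)
              (Cond (ILess 2 6) (Seq (Instr (RCopy (4, 3) (2, 4))) (Instr (ISuc 4))) (Instr Nop)))
            (Cond (ILess 1 6)
              (Cond (ILess 2 6) (Instr Nop) (Seq (Instr (RCopy (4, 3) (3, 5))) (Instr (ISuc 5))))
              (Instr Nop)))
    (Seq (Instr (RAdd (0, 3) (1, 3) (4, 3)))
    (Seq (Instr (RSub (1, 3) (1, 3) (4, 3)))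
    (Seq (Instr (ISuc 2)) (Instr (ISuc 3))))))))"

text \<open>The numbers of entries of \<open>A\<close> and of \<open>B\<close> that precede position \<open>(i, j)\<close> of \<open>X\<close>.\<close>

definition consumed1 :: "nat \<Rightarrow> nat \<Rightarrow> nat \<Rightarrow> nat" where
  "consumed1 n i j = (if i < n then i * n + min (j - n) n else n * n)"

definition consumed2 :: "nat \<Rightarrow> nat \<Rightarrow> nat \<Rightarrow> nat" where
  "consumed2 n i j = (if i < n then 0 else if i < 2 * n then (i - n) * n + (j - 2 * n) else n * n)"

text \<open>The finished entries form a flat prefix, decoded by \<open>div\<close> and
  \<open>mod\<close>: a round adds just one position, and a row change leaves the prefix as it
  is.\<close>

definition fill_inv ::
  "nat \<Rightarrow> (nat \<Rightarrow> 'a::{ring,monoid_mult}) \<Rightarrow> (nat \<Rightarrow> 'a) \<Rightarrow> nat \<Rightarrow> nat \<Rightarrow> 'a state \<Rightarrow> bool" where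
  "fill_inv n a b i j s \<longleftrightarrow>
     fst s 0 = n \<and> fst s 1 = i \<and> fst s 2 = j \<and> fst s 3 = i * (3 * n) + j \<and>
     fst s 4 = consumed1 n i j \<and> fst s 5 = consumed2 n i j \<and> fst s 6 = 2 * n \<and> fst s 7 = 3 * n \<and>
     (\<forall>p < n * n. snd s 2 p = a p \<and> snd s 3 p = b p) \<and>
     (\<forall>p < i * (3 * n) + j.
        snd s 0 p = delta (p div (3 * n)) (p mod (3 * n))
          + block_entry n a b (p div (3 * n)) (p mod (3 * n)) \<and>
        snd s 1 p = delta (p div (3 * n)) (p mod (3 * n))
          - block_entry n a b (p div (3 * n)) (p mod (3 * n)))"

lemma row_major_less:
  fixes i j n :: nat
  assumes "i < n" "j < n"
  shows "i * n + j < n * n"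
proof -
  have "i * n + j < Suc i * n" using assms by simp
  also have "\<dots> \<le> n * n" using assms by (intro mult_le_mono1) simp
  finally show ?thesis .
qed

text \<open>When (i, j) lies in the block of A or of B, the next unread entry of the saved copy is
  the entry of X; elsewhere that entry is 0 and nothing is consumed.\<close>

lemma result_fill_body:
  assumes inv: "fill_inv n a b i j (R, M)" and ij: "i < 3 * n" "j < 3 * n"
  shows "fill_inv n a b i (Suc j) (result fill_body (R, M))"
proof -
  let ?p = "i * (3 * n) + j"
  have dm: "?p div (3 * n) = i" "?p mod (3 * n) = j"
    using ij by simp_all
  have R: "R 0 = n" "R (Suc 0) = i" "R 2 = j" "R 3 = ?p" "R 4 = consumed1 n i j"
    "R 5 = consumed2 n i j" "R 6 = 2 * n" "R 7 = 3 * n"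
    using inv by (simp_all add: fill_inv_def)
  have M: "\<And>p. p < n * n \<Longrightarrow> M 2 p = a p" "\<And>p. p < n * n \<Longrightarrow> M 3 p = b p"
    using inv by (simp_all add: fill_inv_def)
  let ?x = "block_entry n a b i j"
  \<comment> \<open>Array 4 is scratch space, so \<open>M'\<close> is left open there.\<close>
  obtain M' where M': "result fill_body (R, M) =
      (R(4 := consumed1 n i (Suc j), 5 := consumed2 n i (Suc j), 2 := Suc j, 3 := Suc ?p), M')"
    "M' 0 = (M 0)(?p := delta i j + ?x)" "M' 1 = (M 1)(?p := delta i j - ?x)"
    "M' 2 = M 2" "M' 3 = M 3"
  proof -
    \<comment> \<open>One case for each path through the nested conditionals.\<close>
    consider "i < n" "j < n" | "i < n" "n \<le> j" "j < 2 * n" | "i < n" "2 * n \<le> j"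
      | "n \<le> i" "i < 2 * n" "j < 2 * n" | "n \<le> i" "i < 2 * n" "2 * n \<le> j" | "2 * n \<le> i"
      by linarith
    then show ?thesis
    proof cases
      case 1
      then have "consumed1 n i (Suc j) = R 4" "consumed2 n i (Suc j) = R 5" "?x = 0"
        unfolding R using ij M row_major_less[of i n "j - n"] row_major_less[of "i - n" n "j - 2 * n"]
        by (simp_all add: consumed1_def consumed2_def block_entry_def)
      with 1 show ?thesis
        \<comment> \<open>Splitting on \<open>i = j\<close> decides the diagonal test;
          \<open>fun_upd_idem\<close> absorbs the updates of registers 4 and 5 that keep their
          value.\<close>
        by (intro that[of "snd (result fill_body (R, M))"]; cases "i = j";
            simp add: fill_body_def R(1-4,7) delta_def fun_upd_idem)
    next
      case 2
      \<comment> \<open>Here \<open>R 4\<close> is \<open>i * n + (j - n)\<close>;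
        \<open>row_major_less\<close> puts it below \<open>n * n\<close>, where array 2 is known to
        agree with \<open>a\<close>.\<close>
      then have "consumed1 n i (Suc j) = Suc (R 4)" "consumed2 n i (Suc j) = R 5" "?x = M 2 (R 4)"
        unfolding R using ij M row_major_less[of i n "j - n"] row_major_less[of "i - n" n "j - 2 * n"]
        by (simp_all add: consumed1_def consumed2_def block_entry_def)
      with 2 show ?thesis
        by (intro that[of "snd (result fill_body (R, M))"]; cases "i = j";
            simp add: fill_body_def R(1-4,7) delta_def fun_upd_idem)
    next
      case 3
      then have "consumed1 n i (Suc j) = R 4" "consumed2 n i (Suc j) = R 5" "?x = 0"
        unfolding R using ij M row_major_less[of i n "j - n"] row_major_less[of "i - n" n "j - 2 * n"]
        by (simp_all add: consumed1_def consumed2_def block_entry_def)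
      with 3 show ?thesis
        by (intro that[of "snd (result fill_body (R, M))"]; cases "i = j";
            simp add: fill_body_def R(1-4,7) delta_def fun_upd_idem)
    next
      case 4
      then have "consumed1 n i (Suc j) = R 4" "consumed2 n i (Suc j) = R 5" "?x = 0"
        unfolding R using ij M row_major_less[of i n "j - n"] row_major_less[of "i - n" n "j - 2 * n"]
        by (simp_all add: consumed1_def consumed2_def block_entry_def)
      with 4 show ?thesis
        by (intro that[of "snd (result fill_body (R, M))"]; cases "i = j";
            simp add: fill_body_def R(1-4,7) delta_def fun_upd_idem)
    next
      case 5
      then have "consumed1 n i (Suc j) = R 4" "consumed2 n i (Suc j) = Suc (R 5)" "?x = M 3 (R 5)"
        unfolding R using ij M row_major_less[of i n "j - n"] row_major_less[of "i - n" n "j - 2 * n"]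
        by (simp_all add: consumed1_def consumed2_def block_entry_def)
      with 5 show ?thesis
        by (intro that[of "snd (result fill_body (R, M))"]; cases "i = j";
            simp add: fill_body_def R(1-4,7) delta_def fun_upd_idem)
    next
      case 6
      then have "consumed1 n i (Suc j) = R 4" "consumed2 n i (Suc j) = R 5" "?x = 0"
        unfolding R using ij M row_major_less[of i n "j - n"] row_major_less[of "i - n" n "j - 2 * n"]
        by (simp_all add: consumed1_def consumed2_def block_entry_def)
      with 6 show ?thesis
        by (intro that[of "snd (result fill_body (R, M))"]; cases "i = j";
            simp add: fill_body_def R(1-4,7) delta_def fun_upd_idem)
    qed
  qed
  from inv M'(2-) dm show ?thesis
    unfolding M'(1) fill_inv_def by (auto simp: less_Suc_eq)
qed

lemma hoare_fill:
  "hoare (fill_inv n a b 0 0) (double_loop 1 2 7 fill_body)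
     (3 * n * (3 * n * (cost fill_body + 1) + 4) + 1) (fill_inv n a b (3 * n) 0)"
proof (rule hoare_double_loop)
  have loop_free: "loop_free fill_body" by (simp add: fill_body_def)
  show "hoare (fill_inv n a b i j) fill_body (cost fill_body) (fill_inv n a b i (Suc j))"
    if "i < 3 * n" "j < 3 * n" for i j
    by (rule hoare_loop_free[OF loop_free order_refl]) (rule result_fill_body[OF _ that])
  show "fill_inv n a b (Suc i) 0 (R(1 := Suc i, 2 := 0), M)"
    if "i < 3 * n" "fill_inv n a b i (3 * n) (R, M)" for i R M
  proof -
    \<comment> \<open>At the end of a row of the first block row the \<open>min\<close> has reached
      \<open>n\<close>, a full row of A; at \<open>Suc i = n\<close> this exhausts A.\<close>
    have "consumed1 n (Suc i) 0 = consumed1 n i (3 * n)"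
      by (cases "Suc i = n") (auto simp: consumed1_def)
    moreover have "consumed2 n (Suc i) 0 = consumed2 n i (3 * n)"
    proof (cases "Suc i = 2 * n")
      case True
      \<comment> \<open>The last row of the middle block row exhausts B.\<close>
      then have "n * n = (i - n) * n + n" by (cases n) (auto simp: algebra_simps)
      with True show ?thesis by (auto simp: consumed2_def)
    next
      case False
      then show ?thesis by (auto simp: consumed2_def Suc_diff_le)
    qed
    ultimately show ?thesis
      using that(2) by (simp add: fill_inv_def add.commute)
  qed
qed (simp add: fill_inv_def)

text \<open>The update of register 0 is the last instruction of the program: an instance keeps its
  size there.\<close>

lemma fill_inv_stores_instance:
  assumes "fill_inv n a b (3 * n) 0 (R, M)"
  shows "stores_instance (3 * n) (one_plus_block n a b) (one_minus_block n a b) (R(0 := R 7), M)"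
  using assms row_major_less[of _ "3 * n"]
  by (auto simp: stores_instance_def fill_inv_def one_plus_block_def one_minus_block_def)

section \<open>The complete program and its running time\<close>

definition reduction :: com where
  "reduction =
     Seq (double_loop 1 2 0 save_body)
    (Seq bounds_init
    (Seq (While (ILess 1 0) bounds_body)
    (Seq (Instr (IConst 1 0))
    (Seq (double_loop 1 2 7 fill_body)
         (Instr (ICopy 0 7))))))"

text \<open>Nested like the \<open>Seq\<close>s of \<open>reduction\<close>, so that
  \<open>hoare_Seq\<close> applies without rearranging the sum.\<close>

definition reduction_time :: "nat \<Rightarrow> nat" where
  "reduction_time n =
     n * (n * 5 + 4) + 1 + (4 + (n * 5 + 1 + (1 +
       (3 * n * (3 * n * (cost fill_body + 1) + 4) + 1 + 1))))"

lemma hoare_reduction: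
  "hoare (save_inv n a b 0 0) reduction (reduction_time n)
     (stores_instance (3 * n) (one_plus_block n a b) (one_minus_block n a b))"
proof -
  have 1: "hoare (bounds_inv n a b n) (Instr (IConst 1 0)) 1 (fill_inv n a b 0 0)"
    by (rule hoare_loop_free)
      (auto simp: bounds_inv_def fill_inv_def consumed1_def consumed2_def)
  have 2: "hoare (fill_inv n a b (3 * n) 0) (Instr (ICopy 0 7)) 1
     (stores_instance (3 * n) (one_plus_block n a b) (one_minus_block n a b))"
    by (rule hoare_loop_free) (use fill_inv_stores_instance in auto)
  show ?thesis
    unfolding reduction_def reduction_time_def
    by (intro hoare_Seq[OF hoare_save] hoare_Seq[OF hoare_bounds_init] hoare_Seq[OF hoare_bounds]
        hoare_Seq[OF 1] hoare_Seq[OF hoare_fill] 2)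
qed

lemma reduction_time_bigo: "(\<lambda>n. real (reduction_time n)) \<in> O(\<lambda>n. real n ^ 2)"
\<comment> \<open>44 = 14 + 21 + 9: for \<open>n\<close> at least 1, the linear and the constant
  term are absorbed into \<open>n * n\<close>.\<close>
proof (rule bigoI[of _ "real (9 * cost fill_body + 44)"], rule eventually_sequentiallyI[of 1])
  fix n :: nat assume "1 \<le> n"
  then have n: "n \<le> n * n" "1 \<le> n * n" by (auto simp: Suc_le_eq)
  have "reduction_time n = (9 * cost fill_body + 14) * (n * n) + 21 * n + 9"
    by (simp add: reduction_time_def algebra_simps)
  also have "\<dots> \<le> (9 * cost fill_body + 44) * (n * n)"
    using n unfolding add_mult_distrib by linarith
  finally have "real (reduction_time n) \<le> real ((9 * cost fill_body + 44) * (n * n))"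
    by (rule of_nat_mono)
  then show "norm (real (reduction_time n)) \<le> real (9 * cost fill_body + 44) * norm (real n ^ 2)"
    by (simp add: power2_eq_square)
qed

theorem theorem5p2:
  shows "\<exists>T :: nat \<Rightarrow> nat. (\<lambda>n. real (T n)) \<in> O(\<lambda>n. real n ^ 2) \<and>
           reduces_within (all_zeroes :: 'a::{ring,monoid_mult} matrix_problem)
             inverse_verification (\<lambda>n. 3 * n) T"
proof (intro exI[of _ reduction_time] conjI reduction_time_bigo)
  show "reduces_within (all_zeroes :: 'a matrix_problem) inverse_verification (\<lambda>n. 3 * n)
    reduction_time"
    unfolding reduces_within_def
  proof (intro exI[of _ reduction] allI ballI)
    fix n and A B :: "'a mat"
    assume A: "A \<in> carrier_mat n n" and B: "B \<in> carrier_mat n n"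
    \<comment> \<open>The raw input arrays, as \<open>save_inv\<close> fixes arrays 0 and 1 at every
      address.\<close>
    define a b where "a = snd (input_state n A B) 0" and "b = snd (input_state n A B) 1"
    have ab: "a (i * n + j) = A $$ (i, j)" "b (i * n + j) = B $$ (i, j)" if "i < n" "j < n" for i j
      using stores_instance_input_state[of n A B] that
      by (auto simp: stores_instance_def a_def b_def)
    have "save_inv n a b 0 0 (input_state n A B)"
      by (simp add: save_inv_def a_def b_def) (simp add: input_state_def)
    then obtain t s where t: "t \<le> reduction_time n" "runs reduction (input_state n A B) t s"
      and s: "stores_instance (3 * n) (one_plus_block n a b) (one_minus_block n a b) s"
      using hoare_reduction[of n a b] unfolding hoare_def by blast
    have "one_plus_block n a b \<in> carrier_mat (3 * n) (3 * n)"
      "one_minus_block n a b \<in> carrier_mat (3 * n) (3 * n)"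
      by (simp_all add: one_plus_block_def one_minus_block_def)
    with t s all_zeroes_iff_inverse_verification[OF A B ab]
    show "\<exists>t s. runs reduction (input_state n A B) t s \<and> t \<le> reduction_time n \<and>
          (\<exists>A' \<in> carrier_mat (3 * n) (3 * n). \<exists>B' \<in> carrier_mat (3 * n) (3 * n).
             stores_instance (3 * n) A' B' s \<and>
             (all_zeroes n A B \<longleftrightarrow> inverse_verification (3 * n) A' B'))"
      by blast
  qed
qed

end
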